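(* For $i,j\in\{0,1,2,3\}$ let $(\mathrm{I})_{ij}$ and $(\mathrm{II})_{ij}$ be the identities obtained from $$(\mathrm I)\quad xt_1yt_2\cdot xy\cdot t_3yt_4x\bumpeq xt_1yt_2\cdot yx\cdot t_3yt_4x,\qquad (\mathrm{II})\quad xt_1yt_2\cdot xy\cdot t_3xt_4y\bumpeq xt_1yt_2\cdot yx\cdot t_3xt_4y,$$ respectively, by replacing, on both sides, the $i$-th occurrence of $x$ by $x^*$ and the $j$-th occurrence of $y$ by $y^*$ (for $i=0$ no $x$ is replaced, for $j=0$ no $y$ is replaced). The identities $(\mathrm I)_{ij}$, $(\mathrm{II})_{ij}$ ($i,j=0,1,2,3$) together with $$(\mathrm{III})\quad xt_1xt_2x^*t_3x\bumpeq xt_1x^*t_2xt_3x,\qquad(\mathrm{IV})\quad xt_1xt_2x^*t_3x^*\bumpeq xt_1x^*t_2xt_3x^*$$ form a basis for the (involutory) monoid identities of $\mathfrak L^\flat_2$ and of $\overline{\mathfrak L^\flat_2}$, both equipped with rotation ${}^\rho$. A basis of (involutory) semigroup identities is obtained by deleting every possible choice of a subset of the set of letters $\{t_1,t_2,t_3,t_4\}$ in $(\mathrm I)_{ij}$ and $(\mathrm{II})_{ij}$ and every possible choice of a subset of $\{t_1,t_2,t_3\}$ in $(\mathrm{III})$ and $(\mathrm{IV})$ (that is, it consists of all identities arising in this way).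
   Context: Involutory semigroups (monoids) are semigroups (monoids) with a unary operation ${}^*$ satisfying $(ab)^*=b^*a^*$ and $(a^* )^*=a$. Identities are pairs of words over $X\cup X^*$ ($X$ a countably infinite set of variables, $X^*=\{x^*:x\in X\}$ a disjoint copy); an identity holds in an involutory semigroup if both sides have equal values under every substitution for the variables, where $x^*$ takes the value of the involution on the value of $x$. A set $\Sigma$ of identities holding in an involutory monoid $\mathcal S$ is a basis for its monoid (respectively semigroup) identities if every identity holding in $\mathcal S$ holds in every involutory monoid (respectively involutory semigroup) satisfying $\Sigma$. The monoid $\mathfrak L^\flat_2$ (respectively $\overline{\mathfrak L^\flat_2}$) consists of circle-free planar string diagrams in a rectangle with two incoming points on one side and two outgoing points on the opposite side, up to isotopy, whose regions are labelled by elements of $\mathcal S=\mathbb N_0$ (respectively $\mathcal S=\mathbb Z$). Explicitly, the elements are: - the rank 2 elements $p|q|r$ with $p,q,r\in\mathcal S$ (two parallel transversal strings; $p,q,r$ are the labels of the three regions in their order, $q$ being the label of the region between the strings); - the rank 0 elements $a)b(c$ with $a,b,c\in\mathcal S$ (one string joining the two incoming points, cutting off a region labelled $a$; one string joining the two outgoing points, cutting off a region labelled $c$; the remaining region is labelled $b$). The product concatenates diagrams, adds the labels of merged regions, and a created circle enclosing total label $x$ contributes $x+1$ to the region containing it: $p|q|r\cdot u|v|w=(p+u)|(q+v)|(r+w)$; $\;p|q|r\cdot a)b(c=(q+a)\,)\,(p+b+r)\,(\,c$; $\;a)b(c\cdot p|q|r=a\,)\,(p+b+r)\,(\,(c+q)$;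 $\;a)b(c\cdot d)e(f=a\,)\,(b+c+1+d+e)\,(\,f$. The rotation ${}^\rho$ (rotation of the rectangle by $180^\circ$) is the involution $(p|q|r)^\rho=r|q|p$, $(a)b(c)^\rho=c)b(a$; it interprets the unary operation ${}^*$. *)

theory Defs
  imports Main
begin

section \<open>Involutory semigroups and monoids\<close>

locale involutory_semigroup = semigroup f
  for f :: "'a \<Rightarrow> 'a \<Rightarrow> 'a" +
  fixes star :: "'a \<Rightarrow> 'a"
  assumes star_mult: "star (f a b) = f (star b) (star a)"
    and star_star: "star (star a) = a"

locale involutory_monoid = monoid f e + involutory_semigroup f star
  for f :: "'a \<Rightarrow> 'a \<Rightarrow> 'a" and e :: 'a and star :: "'a \<Rightarrow> 'a"


section \<open>Words and identities\<close>

text \<open>The variables are the natural numbers; \<open>Star n\<close> is the formal letter \<open>x\<^sub>n\<^sup>*\<close>.\<close>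

datatype letter = Var nat | Star nat

type_synonym word = "letter list"

type_synonym identity = "word \<times> word"

fun letter_val :: "('a \<Rightarrow> 'a) \<Rightarrow> (nat \<Rightarrow> 'a) \<Rightarrow> letter \<Rightarrow> 'a" where
  "letter_val star \<phi> (Var n) = \<phi> n"
| "letter_val star \<phi> (Star n) = star (\<phi> n)"

fun monoid_val ::
  "('a \<Rightarrow> 'a \<Rightarrow> 'a) \<Rightarrow> 'a \<Rightarrow> ('a \<Rightarrow> 'a) \<Rightarrow> (nat \<Rightarrow> 'a) \<Rightarrow> word \<Rightarrow> 'a" where
  "monoid_val f e star \<phi> [] = e"
| "monoid_val f e star \<phi> (l # w) = f (letter_val star \<phi> l) (monoid_val f e star \<phi> w)"

text \<open>In a semigroup the empty word has no value: \<open>semigroup_val\<close> is unspecified there and is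
  only used for nonempty words.\<close>

fun semigroup_val ::
  "('a \<Rightarrow> 'a \<Rightarrow> 'a) \<Rightarrow> ('a \<Rightarrow> 'a) \<Rightarrow> (nat \<Rightarrow> 'a) \<Rightarrow> word \<Rightarrow> 'a" where
  "semigroup_val f star \<phi> [l] = letter_val star \<phi> l"
| "semigroup_val f star \<phi> (l # m # w) =
     f (letter_val star \<phi> l) (semigroup_val f star \<phi> (m # w))"

definition monoid_holds ::
  "('a \<Rightarrow> 'a \<Rightarrow> 'a) \<Rightarrow> 'a \<Rightarrow> ('a \<Rightarrow> 'a) \<Rightarrow> identity \<Rightarrow> bool" where
  "monoid_holds f e star i \<longleftrightarrow>
     (\<forall>\<phi>. monoid_val f e star \<phi> (fst i) = monoid_val f e star \<phi> (snd i))"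

definition semigroup_identities :: "identity set" where
  "semigroup_identities = {(u, v). u \<noteq> [] \<and> v \<noteq> []}"

definition semigroup_holds ::
  "('a \<Rightarrow> 'a \<Rightarrow> 'a) \<Rightarrow> ('a \<Rightarrow> 'a) \<Rightarrow> identity \<Rightarrow> bool" where
  "semigroup_holds f star i \<longleftrightarrow>
     (\<forall>\<phi>. semigroup_val f star \<phi> (fst i) = semigroup_val f star \<phi> (snd i))"

text \<open>HOL cannot quantify over types inside a formula, so the type \<open>'m\<close> carrying the models of
  \<open>\<Sigma>\<close> is an explicit parameter. A theorem \<open>is_monoid_basis TYPE('m) \<Sigma> f e star\<close> with \<open>'m\<close> a type
  variable speaks about all involutory monoids; likewise for semigroups.\<close>

definition is_monoid_basis ::
  "'m itself \<Rightarrow> identity set \<Rightarrow> ('a \<Rightarrow> 'a \<Rightarrow> 'a) \<Rightarrow> 'a \<Rightarrow> ('a \<Rightarrow> 'a) \<Rightarrow> bool" where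
  "is_monoid_basis (T :: 'm itself) \<Sigma> f e star \<longleftrightarrow>
     (\<forall>i\<in>\<Sigma>. monoid_holds f e star i) \<and>
     (\<forall>i. monoid_holds f e star i \<longrightarrow>
        (\<forall>(g :: 'm \<Rightarrow> 'm \<Rightarrow> 'm) d s.
           involutory_monoid g d s \<and> (\<forall>j\<in>\<Sigma>. monoid_holds g d s j) \<longrightarrow> monoid_holds g d s i))"

definition is_semigroup_basis ::
  "'m itself \<Rightarrow> identity set \<Rightarrow> ('a \<Rightarrow> 'a \<Rightarrow> 'a) \<Rightarrow> ('a \<Rightarrow> 'a) \<Rightarrow> bool" where
  "is_semigroup_basis (T :: 'm itself) \<Sigma> f star \<longleftrightarrow>
     \<Sigma> \<subseteq> semigroup_identities \<and>
     (\<forall>i\<in>\<Sigma>. semigroup_holds f star i) \<and>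
     (\<forall>i\<in>semigroup_identities. semigroup_holds f star i \<longrightarrow>
        (\<forall>(g :: 'm \<Rightarrow> 'm \<Rightarrow> 'm) s.
           involutory_semigroup g s \<and> (\<forall>j\<in>\<Sigma>. semigroup_holds g s j) \<longrightarrow> semigroup_holds g s i))"


section \<open>Labelled diagrams\<close>

text \<open>\<open>Rank2 p q r\<close> is the diagram \<open>p|q|r\<close> and \<open>Rank0 a b c\<close> the diagram \<open>a)b(c\<close>; the monoids with
  labels in \<open>\<nat>\<^sub>0\<close> and in \<open>\<int>\<close> are the types \<open>nat diagram\<close> and \<open>int diagram\<close>.\<close>

datatype 'l diagram = Rank2 'l 'l 'l | Rank0 'l 'l 'l

fun dmult :: "'l::comm_semiring_1 diagram \<Rightarrow> 'l diagram \<Rightarrow> 'l diagram" where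
  "dmult (Rank2 p q r) (Rank2 u v w) = Rank2 (p + u) (q + v) (r + w)"
| "dmult (Rank2 p q r) (Rank0 a b c) = Rank0 (q + a) (p + b + r) c"
| "dmult (Rank0 a b c) (Rank2 p q r) = Rank0 a (p + b + r) (c + q)"
| "dmult (Rank0 a b c) (Rank0 d e f) = Rank0 a (b + c + 1 + d + e) f"

definition dunit :: "'l::comm_semiring_1 diagram" where
  "dunit = Rank2 0 0 0"

fun rotation :: "'l diagram \<Rightarrow> 'l diagram" where
  "rotation (Rank2 p q r) = Rank2 r q p"
| "rotation (Rank0 a b c) = Rank0 c b a"

lemma involutory_monoid_diagram:
  "involutory_monoid (dmult :: 'l::comm_semiring_1 diagram \<Rightarrow> _) dunit rotation"
proof
  fix a b c :: "'l diagram"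
  show "dmult (dmult a b) c = dmult a (dmult b c)"
    by (cases a; cases b; cases c) (simp_all add: ac_simps)
  show "dmult dunit a = a" "dmult a dunit = a"
    by (cases a; simp add: dunit_def)+
  show "rotation (dmult a b) = dmult (rotation b) (rotation a)"
    by (cases a; cases b) (simp_all add: ac_simps)
  show "rotation (rotation a) = a"
    by (cases a) simp_all
qed


section \<open>The identities\<close>

abbreviation X :: letter where "X \<equiv> Var 0"
abbreviation X' :: letter where "X' \<equiv> Star 0"
abbreviation Y :: letter where "Y \<equiv> Var 1"
abbreviation T1 :: letter where "T1 \<equiv> Var 2"
abbreviation T2 :: letter where "T2 \<equiv> Var 3"
abbreviation T3 :: letter where "T3 \<equiv> Var 4"
abbreviation T4 :: letter where "T4 \<equiv> Var 5"

text \<open>\<open>star_occ n k w\<close> replaces the \<open>k\<close>-th occurrence (counted from 1) of the letter \<open>Var n\<close> by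
  \<open>Star n\<close>. It leaves \<open>w\<close> unchanged for \<open>k = 0\<close>, since then \<open>k - 1 = 0\<close> on the naturals.\<close>

fun star_occ :: "nat \<Rightarrow> nat \<Rightarrow> word \<Rightarrow> word" where
  "star_occ n k [] = []"
| "star_occ n k (l # w) =
     (if l = Var n then (if k = 1 then Star n # w else l # star_occ n (k - 1) w)
      else l # star_occ n k w)"

definition on_both_sides :: "(word \<Rightarrow> word) \<Rightarrow> identity \<Rightarrow> identity" where
  "on_both_sides h = map_prod h h"

definition identity_I :: identity where
  "identity_I =
     ([X, T1, Y, T2, X, Y, T3, Y, T4, X],
      [X, T1, Y, T2, Y, X, T3, Y, T4, X])"

definition identity_II :: identity where
  "identity_II =
     ([X, T1, Y, T2, X, Y, T3, X, T4, Y],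
      [X, T1, Y, T2, Y, X, T3, X, T4, Y])"

definition identity_III :: identity where
  "identity_III = ([X, T1, X, T2, X', T3, X], [X, T1, X', T2, X, T3, X])"

definition identity_IV :: identity where
  "identity_IV = ([X, T1, X, T2, X', T3, X'], [X, T1, X', T2, X, T3, X'])"

definition starred :: "identity \<Rightarrow> nat \<Rightarrow> nat \<Rightarrow> identity" where
  "starred e i j = on_both_sides (star_occ 0 i \<circ> star_occ 1 j) e"

definition starred_family :: "identity set" where
  "starred_family =
     {starred e i j | e i j. e \<in> {identity_I, identity_II} \<and> i \<in> {0, 1, 2, 3} \<and> j \<in> {0, 1, 2, 3}}"

definition delete_letters :: "letter set \<Rightarrow> identity \<Rightarrow> identity" where
  "delete_letters D = on_both_sides (filter (\<lambda>l. l \<notin> D))"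

definition diagram_monoid_identities :: "identity set" where
  "diagram_monoid_identities = starred_family \<union> {identity_III, identity_IV}"

definition diagram_semigroup_identities :: "identity set" where
  "diagram_semigroup_identities =
     {delete_letters D e | D e. D \<subseteq> {T1, T2, T3, T4} \<and> e \<in> starred_family} \<union>
     {delete_letters D e | D e. D \<subseteq> {T1, T2, T3} \<and> e \<in> {identity_III, identity_IV}}"

end

theory Submission
  imports Defs
begin

text \<open>
  Call an occurrence of a variable in a word \<^emph>\<open>inner\<close> if it is neither the first nor the last
  occurrence of that variable, where \<open>x\<close> and \<open>x*\<close> count as the same variable. The identities of
  the proposed basis say exactly two things: adjacent inner occurrences of different variables
  commute, in the orders of surrounding occurrences and with the stars that (I) and (II) list up to
  renaming, and inner occurrences of \<open>x\<close> and \<open>x*\<close> may trade places over any distance, by (III) and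
  (IV). Both moves form the relation \<open>exchange\<close>, and the theorem amounts to the claim that an
  identity holds in a diagram monoid iff its sides are connected by exchanges.

  Exchanges are invisible in the diagram monoids. If the letters concerned have rank 2, this is the
  commutativity of rank 2 diagrams, or a short computation for \<open>x\<close> and \<open>x*\<close>. If one of them
  has rank 0, then, the occurrence being inner, it lies between two diagrams of rank 0. Such a pair
  of diagrams absorbs all labels between them into a single region, so that only an additive
  quantity, the \<open>weight\<close>, of the inner part survives (\<open>dmult_between_rank0\<close>).

  Conversely, substitutions with at most one variable of rank 0 read off from a word how often each
  letter occurs, the letter at the first occurrence of each variable \<open>x\<close> and the number of
  occurrences of every variable before it, and the same data for last occurrences
  (\<open>letter_count_eq\<close>, \<open>first_occurrence_eq\<close>, \<open>last_occurrence_eq\<close>). Words that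
  agree in these data are connected by exchanges. This is shown by extending a common prefix letter
  by letter. If the words continue with letters of different variables \<open>x\<close> and \<open>y\<close>, the next \<open>x\<close>
  of the second word has to be moved to the left, and every letter that it passes, as well as \<open>x\<close>
  itself, must be inner: the first or last occurrence of a variable \<open>z\<close> there would see a number
  of \<open>x\<close> different from the one it sees in the first word (\<open>bring_variable_forward\<close>).
  If the words continue with \<open>x\<close> and \<open>x*\<close>, some later inner occurrence can be traded for the
  letter required (\<open>bring_letter_forward\<close>).

  The semigroup case differs from the monoid case in that the pieces substituted for the letters
  \<open>t\<^sub>k\<close> must be nonempty; deleting \<open>t\<^sub>k\<close> supplies the missing instances. The
  monoid case is reduced to it by substituting the unit for the deleted letters.
\<close>

text \<open>The variable of the letter \<open>Y\<close> is \<open>1\<close>; it should not be rewritten to \<open>Suc 0\<close>.\<close>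

declare One_nat_def [simp del]

section \<open>Exchanging inner occurrences\<close>

fun var_of :: "letter \<Rightarrow> nat" where
  "var_of (Var n) = n"
| "var_of (Star n) = n"

fun bar :: "letter \<Rightarrow> letter" where
  "bar (Var n) = Star n"
| "bar (Star n) = Var n"

lemma bar_bar [simp]: "bar (bar l) = l"
  by (cases l) auto

lemma var_of_bar [simp]: "var_of (bar l) = var_of l"
  by (cases l) auto

lemma bar_neq [simp]: "bar l \<noteq> l" "l \<noteq> bar l"
  by (cases l; simp)+

lemma same_var: "var_of a = var_of b \<Longrightarrow> b = a \<or> b = bar a"
  by (cases a; cases b) auto

abbreviation vars :: "word \<Rightarrow> nat set" where
  "vars w \<equiv> var_of ` set w"

lemma split_first_var:
  assumes "x \<in> vars w"
  obtains p c s where "w = p @ c # s" "var_of c = x" "x \<notin> vars p"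
proof -
  have "\<exists>l\<in>set w. var_of l = x" using assms by auto
  then show thesis
    by (rule split_list_first_propE) (rule that, auto)
qed

lemma split_last_var:
  assumes "x \<in> vars w"
  obtains p c s where "w = p @ c # s" "var_of c = x" "x \<notin> vars s"
proof -
  have "\<exists>l\<in>set w. var_of l = x" using assms by auto
  then show thesis
    by (rule split_list_last_propE) (rule that, auto)
qed

lemma split_two_vars:
  assumes "x \<in> vars w" "y \<in> vars w" "x \<noteq> y"
  obtains c d p t s where "w = p @ c # t @ d # s"
    "var_of c = x \<and> var_of d = y \<or> var_of c = y \<and> var_of d = x"
proof -
  obtain p c s where c: "w = p @ c # s" "var_of c = x"
    using split_first_var[OF assms(1)] .
  with assms(2,3) consider "y \<in> vars p" | "y \<in> vars s" by auto
  then show thesis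
  proof cases
    case 1
    then obtain p' d t where "p = p' @ d # t" "var_of d = y" by (rule split_first_var)
    then show ?thesis using that[of p' d t c s] c by simp
  next
    case 2
    then obtain t d s' where "s = t @ d # s'" "var_of d = y" by (rule split_first_var)
    then show ?thesis using that[of p c t d s'] c by simp
  qed
qed

text \<open>
  Membership in the variables of the prefix and of the suffix says that an occurrence is inner. As
  \<open>bar\<close> is an involution, \<open>star\<close> covers the replacement in both directions.
\<close>

inductive exchange :: "word \<Rightarrow> word \<Rightarrow> bool" where
  swap: "\<lbrakk>var_of a \<noteq> var_of b; var_of a \<in> vars p; var_of b \<in> vars p;
          var_of a \<in> vars s; var_of b \<in> vars s\<rbrakk>
         \<Longrightarrow> exchange (p @ a # b # s) (p @ b # a # s)"
| star: "\<lbrakk>var_of a \<in> vars p; var_of a \<in> vars s\<rbrakk>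
         \<Longrightarrow> exchange (p @ a # m @ bar a # s) (p @ bar a # m @ a # s)"

lemma exchange_nonempty: "exchange u v \<Longrightarrow> u \<noteq> [] \<and> v \<noteq> []"
  by (induction rule: exchange.induct) auto


section \<open>The identities as exchanges\<close>

text \<open>
  A letter with \<open>bar_at i k\<close> is the \<open>k\<close>-th occurrence of a variable whose \<open>i\<close>-th occurrence is
  to be starred; with \<open>i = 0\<close> and \<open>k \<ge> 1\<close> nothing is starred.
\<close>

definition bar_at :: "nat \<Rightarrow> nat \<Rightarrow> letter \<Rightarrow> letter" where
  "bar_at i k l = (if i = k then bar l else l)"

lemma var_of_bar_at [simp]: "var_of (bar_at i k l) = var_of l"
  by (simp add: bar_at_def)

text \<open>
  Starring at most one of three occurrences is enough to reach all eight patterns of stars, because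
  a substitution may replace the variable by its star, which complements the pattern.
\<close>

lemma obtain_bar_at:
  assumes "var_of x1 = var_of x2" "var_of x3 = var_of x2"
  obtains i l where "i \<in> {0, 1, 2, 3}" "x1 = bar_at i 1 l" "x2 = bar_at i 2 l" "x3 = bar_at i 3 l"
proof -
  have "\<exists>i\<in>{0, 1, 2, 3}. \<exists>l. x1 = bar_at i 1 l \<and> x2 = bar_at i 2 l \<and> x3 = bar_at i 3 l"
    using same_var[OF assms(1)] same_var[OF assms(2)] unfolding bar_at_def
    by (elim disjE; simp; metis bar_bar)
  then show thesis using that by blast
qed

lemma starred_I:
  assumes "i \<in> {0, 1, 2, 3}" "j \<in> {0, 1, 2, 3}"
  shows "starred identity_I i j =
    ([bar_at i 1 X, T1, bar_at j 1 Y, T2] @ bar_at i 2 X # bar_at j 2 Y # [T3, bar_at j 3 Y, T4, bar_at i 3 X],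
     [bar_at i 1 X, T1, bar_at j 1 Y, T2] @ bar_at j 2 Y # bar_at i 2 X # [T3, bar_at j 3 Y, T4, bar_at i 3 X])"
  using assms
  by (auto simp: starred_def on_both_sides_def identity_I_def bar_at_def)

lemma starred_II:
  assumes "i \<in> {0, 1, 2, 3}" "j \<in> {0, 1, 2, 3}"
  shows "starred identity_II i j =
    ([bar_at i 1 X, T1, bar_at j 1 Y, T2] @ bar_at i 2 X # bar_at j 2 Y # [T3, bar_at i 3 X, T4, bar_at j 3 Y],
     [bar_at i 1 X, T1, bar_at j 1 Y, T2] @ bar_at j 2 Y # bar_at i 2 X # [T3, bar_at i 3 X, T4, bar_at j 3 Y])"
  using assms
  by (auto simp: starred_def on_both_sides_def identity_II_def bar_at_def)

lemma starred_family_cases: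
  assumes "e \<in> starred_family"
  obtains i j where "i \<in> {0, 1, 2, 3}" "j \<in> {0, 1, 2, 3}" "e = starred identity_I i j"
  | i j where "i \<in> {0, 1, 2, 3}" "j \<in> {0, 1, 2, 3}" "e = starred identity_II i j"
  using assms unfolding starred_family_def by blast

lemma bar_at_notin:
  assumes "D \<subseteq> {T1, T2, T3, T4}"
  shows "bar_at i k X \<notin> D" "bar_at j k Y \<notin> D"
  using assms by (auto simp: bar_at_def)

lemma exchange_filter_swap:
  assumes "var_of a \<noteq> var_of b" "a \<notin> D" "b \<notin> D"
    and "var_of a \<in> vars (filter (\<lambda>l. l \<notin> D) p)" "var_of b \<in> vars (filter (\<lambda>l. l \<notin> D) p)"
    and "var_of a \<in> vars (filter (\<lambda>l. l \<notin> D) s)" "var_of b \<in> vars (filter (\<lambda>l. l \<notin> D) s)"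
  shows "exchange (fst (delete_letters D (p @ a # b # s, p @ b # a # s)))
                  (snd (delete_letters D (p @ a # b # s, p @ b # a # s)))"
  using exchange.swap[OF assms(1,4-7)] assms(2,3)
  by (simp add: delete_letters_def on_both_sides_def)

lemma exchange_filter_star:
  assumes "a \<notin> D" "bar a \<notin> D"
    and "var_of a \<in> vars (filter (\<lambda>l. l \<notin> D) p)" "var_of a \<in> vars (filter (\<lambda>l. l \<notin> D) s)"
  shows "exchange (fst (delete_letters D (p @ a # m @ bar a # s, p @ bar a # m @ a # s)))
                  (snd (delete_letters D (p @ a # m @ bar a # s, p @ bar a # m @ a # s)))"
  using exchange.star[OF assms(3,4)] assms(1,2)
  by (simp add: delete_letters_def on_both_sides_def)

lemma exchange_deleted_starred:
  assumes D: "D \<subseteq> {T1, T2, T3, T4}" and e: "e \<in> starred_family"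
  shows "exchange (fst (delete_letters D e)) (snd (delete_letters D e))"
  using e
proof (cases rule: starred_family_cases)
  case (1 i j)
  show ?thesis
    unfolding 1(3) starred_I[OF 1(1,2)]
    by (rule exchange_filter_swap) (simp_all add: bar_at_notin[OF D])
next
  case (2 i j)
  show ?thesis
    unfolding 2(3) starred_II[OF 2(1,2)]
    by (rule exchange_filter_swap) (simp_all add: bar_at_notin[OF D])
qed

lemma exchange_deleted_III_IV:
  assumes D: "D \<subseteq> {T1, T2, T3}" and e: "e \<in> {identity_III, identity_IV}"
  shows "exchange (fst (delete_letters D e)) (snd (delete_letters D e))"
proof -
  have XD: "X \<notin> D" "X' \<notin> D" using D by auto
  have "identity_III = ([X, T1] @ X # [T2] @ bar X # [T3, X], [X, T1] @ bar X # [T2] @ X # [T3, X])"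
    and "identity_IV = ([X, T1] @ X # [T2] @ bar X # [T3, X'], [X, T1] @ bar X # [T2] @ X # [T3, X'])"
    by (simp_all add: identity_III_def identity_IV_def)
  then obtain z where z: "z \<in> {X, X'}"
    and e_eq: "e = ([X, T1] @ X # [T2] @ bar X # [T3, z], [X, T1] @ bar X # [T2] @ X # [T3, z])"
    using e by blast
  show ?thesis
    unfolding e_eq by (rule exchange_filter_star) (use z XD in \<open>auto\<close>)
qed

lemma exchange_basis:
  assumes "e \<in> diagram_semigroup_identities"
  shows "exchange (fst e) (snd e)"
  using assms exchange_deleted_starred exchange_deleted_III_IV
  unfolding diagram_semigroup_identities_def by blast

lemma monoid_identities_subset: "diagram_monoid_identities \<subseteq> diagram_semigroup_identities"
proof
  fix e assume "e \<in> diagram_monoid_identities"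
  moreover have "e = delete_letters {} e"
    by (cases e) (simp add: delete_letters_def on_both_sides_def)
  ultimately show "e \<in> diagram_semigroup_identities"
    unfolding diagram_monoid_identities_def diagram_semigroup_identities_def by blast
qed


lemma letters_of_monoid_identities:
  assumes "e \<in> diagram_monoid_identities"
  shows "set (fst e) \<union> set (snd e) \<subseteq> range Var \<union> {Star 0, Star 1}"
proof -
  consider "e \<in> starred_family" | "e \<in> {identity_III, identity_IV}"
    using assms unfolding diagram_monoid_identities_def by blast
  then show ?thesis
  proof cases
    case 1
    have "bar_at i k X \<in> range Var \<union> {Star 0, Star 1}" "bar_at i k Y \<in> range Var \<union> {Star 0, Star 1}"
      for i k by (simp_all add: bar_at_def)
    with 1 show ?thesis by (cases rule: starred_family_cases) (simp_all add: starred_I starred_II)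
  next
    case 2
    then show ?thesis by (auto simp: identity_III_def identity_IV_def)
  qed
qed


section \<open>Substitution in involutory semigroups\<close>

definition inverse_word :: "word \<Rightarrow> word" where
  "inverse_word w = rev (map bar w)"

fun subst_letter :: "(nat \<Rightarrow> word) \<Rightarrow> letter \<Rightarrow> word" where
  "subst_letter \<sigma> (Var n) = \<sigma> n"
| "subst_letter \<sigma> (Star n) = inverse_word (\<sigma> n)"

lemma inverse_word_eq_Nil [simp]: "inverse_word w = [] \<longleftrightarrow> w = []"
  by (simp add: inverse_word_def)

lemma inverse_word_single [simp]: "inverse_word [c] = [bar c]"
  by (simp add: inverse_word_def)

lemma subst_bar:
  "subst_letter \<sigma> l = [c] \<Longrightarrow> subst_letter \<sigma> (bar l) = [bar c]"
  by (cases l) (auto simp: inverse_word_def)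

lemma subst_bar_at:
  "subst_letter \<sigma> l = [c] \<Longrightarrow> subst_letter \<sigma> (bar_at i k l) = [bar_at i k c]"
  by (simp add: bar_at_def subst_bar)

context involutory_semigroup
begin

lemma val_Cons:
  "w \<noteq> [] \<Longrightarrow> semigroup_val f star \<phi> (l # w) = f (letter_val star \<phi> l) (semigroup_val f star \<phi> w)"
  by (cases w) auto

lemma val_append:
  "u \<noteq> [] \<Longrightarrow> v \<noteq> [] \<Longrightarrow>
     semigroup_val f star \<phi> (u @ v) = f (semigroup_val f star \<phi> u) (semigroup_val f star \<phi> v)"
proof (induction u)
  case (Cons l u)
  then show ?case by (cases "u = []") (simp_all add: val_Cons assoc)
qed simp

lemma letter_val_bar: "letter_val star \<phi> (bar l) = star (letter_val star \<phi> l)"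
  by (cases l) (simp_all add: star_star)

lemma val_inverse_word:
  "w \<noteq> [] \<Longrightarrow> semigroup_val f star \<phi> (inverse_word w) = star (semigroup_val f star \<phi> w)"
proof (induction w)
  case (Cons l w)
  then show ?case
    by (cases "w = []") (auto simp: inverse_word_def val_append val_Cons star_mult letter_val_bar)
qed simp

lemma val_subst_letter:
  "subst_letter \<sigma> l \<noteq> [] \<Longrightarrow>
   semigroup_val f star \<phi> (subst_letter \<sigma> l) = letter_val star (\<lambda>n. semigroup_val f star \<phi> (\<sigma> n)) l"
  by (cases l) (simp_all add: val_inverse_word)

text \<open>
  In a semigroup a variable cannot be sent to the empty word. Deleting the letters whose images are
  empty makes every such substitution admissible.
\<close>

lemma val_subst:
  assumes "concat (map (subst_letter \<sigma>) w) \<noteq> []"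
  shows "semigroup_val f star \<phi> (concat (map (subst_letter \<sigma>) w)) =
    semigroup_val f star (\<lambda>n. semigroup_val f star \<phi> (\<sigma> n)) (filter (\<lambda>l. subst_letter \<sigma> l \<noteq> []) w)"
  using assms
proof (induction w)
  case (Cons l w)
  show ?case
  proof (cases "concat (map (subst_letter \<sigma>) w) = []")
    case True
    then have "filter (\<lambda>l. subst_letter \<sigma> l \<noteq> []) w = []" by (auto simp: filter_empty_conv)
    with True Cons.prems show ?thesis by (simp add: val_subst_letter del: concat_eq_Nil_conv)
  next
    case False
    then have "filter (\<lambda>l. subst_letter \<sigma> l \<noteq> []) w \<noteq> []" by (auto simp: filter_empty_conv)
    with False Cons.IH show ?thesis by (auto simp: val_append val_Cons val_subst_letter)
  qed
qed simp

lemma val_subst_deleted: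
  assumes holds: "semigroup_holds f star (delete_letters D (u, v))"
    and D: "\<And>l. l \<in> set (fst (u, v)) \<union> set (snd (u, v)) \<Longrightarrow> l \<in> D \<longleftrightarrow> subst_letter \<sigma> l = []"
    and ne: "concat (map (subst_letter \<sigma>) u) \<noteq> []" "concat (map (subst_letter \<sigma>) v) \<noteq> []"
  shows "semigroup_val f star \<phi> (concat (map (subst_letter \<sigma>) u)) =
         semigroup_val f star \<phi> (concat (map (subst_letter \<sigma>) v))"
proof -
  have "filter (\<lambda>l. l \<notin> D) u = filter (\<lambda>l. subst_letter \<sigma> l \<noteq> []) u"
    "filter (\<lambda>l. l \<notin> D) v = filter (\<lambda>l. subst_letter \<sigma> l \<noteq> []) v"
    using D by (auto intro!: filter_cong)
  with holds show ?thesis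
    unfolding val_subst[OF ne(1)] val_subst[OF ne(2)]
    by (simp add: semigroup_holds_def delete_letters_def on_both_sides_def)
qed

lemma val_context:
  assumes "u \<noteq> []" "v \<noteq> []" "semigroup_val f star \<phi> u = semigroup_val f star \<phi> v"
  shows "semigroup_val f star \<phi> (p @ u @ s) = semigroup_val f star \<phi> (p @ v @ s)"
  using assms by (cases "p = []"; cases "s = []") (simp_all add: val_append)

end


section \<open>Exchanges in models of the basis\<close>

text \<open>
  This is the variety of involutory semigroups defined by the proposed semigroup basis. An
  identity of the basis exchanges occurrences within a word that begins and ends with surrounding
  occurrences; the lemmas below substitute arbitrary pieces, possibly empty, for the letters
  \<open>t\<^sub>k\<close> and add a context.
\<close>

locale diagram_variety = involutory_semigroup +
  assumes basis_holds: "j \<in> diagram_semigroup_identities \<Longrightarrow> semigroup_holds f star j"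
begin

lemma val_swap_I:
  assumes x: "var_of x1 = var_of x2" "var_of x3 = var_of x2"
    and y: "var_of y1 = var_of y2" "var_of y3 = var_of y2"
  shows "semigroup_val f star \<phi> (x1 # t1 @ y1 # t2 @ x2 # y2 # t3 @ y3 # t4 @ [x3]) =
         semigroup_val f star \<phi> (x1 # t1 @ y1 # t2 @ y2 # x2 # t3 @ y3 # t4 @ [x3])"
proof -
  obtain i x0 where i: "i \<in> {0, 1, 2, 3}"
    and x_eq: "x1 = bar_at i 1 x0" "x2 = bar_at i 2 x0" "x3 = bar_at i 3 x0"
    using obtain_bar_at[OF x] by blast
  obtain j y0 where j: "j \<in> {0, 1, 2, 3}"
    and y_eq: "y1 = bar_at j 1 y0" "y2 = bar_at j 2 y0" "y3 = bar_at j 3 y0"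
    using obtain_bar_at[OF y] by blast
  define \<sigma> where "\<sigma> = (\<lambda>n. [[x0], [y0], t1, t2, t3, t4] ! n)"
  have \<sigma>: "\<sigma> 0 = [x0]" "\<sigma> 1 = [y0]" "\<sigma> 2 = t1" "\<sigma> 3 = t2" "\<sigma> 4 = t3" "\<sigma> 5 = t4"
    by (simp_all add: \<sigma>_def One_nat_def)
  define D where "D = {l \<in> {T1, T2, T3, T4}. subst_letter \<sigma> l = []}"
  have \<sigma>X: "subst_letter \<sigma> (bar_at i k X) = [bar_at i k x0]"
    and \<sigma>Y: "subst_letter \<sigma> (bar_at j k Y) = [bar_at j k y0]" for k
    by (simp_all add: subst_bar_at \<sigma>)
  have "delete_letters D (starred identity_I i j) \<in> diagram_semigroup_identities"
    using i j unfolding diagram_semigroup_identities_def starred_family_def D_def by blast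
  from basis_holds[OF this]
  have holds: "semigroup_holds f star (delete_letters D (starred identity_I i j))" .
  have D: "l \<in> D \<longleftrightarrow> subst_letter \<sigma> l = []"
    if "l \<in> set (fst (starred identity_I i j)) \<union> set (snd (starred identity_I i j))" for l
    using that unfolding starred_I[OF i j] D_def
    by (auto simp: \<sigma>X \<sigma>Y bar_at_notin[OF order_refl, simplified])
  show ?thesis
    using val_subst_deleted[OF holds[unfolded starred_I[OF i j]] D, of \<phi>]
    unfolding starred_I[OF i j] by (simp add: \<sigma>X \<sigma>Y \<sigma> x_eq y_eq)
qed

lemma val_swap_II:
  assumes x: "var_of x1 = var_of x2" "var_of x3 = var_of x2"
    and y: "var_of y1 = var_of y2" "var_of y3 = var_of y2"
  shows "semigroup_val f star \<phi> (x1 # t1 @ y1 # t2 @ x2 # y2 # t3 @ x3 # t4 @ [y3]) =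
         semigroup_val f star \<phi> (x1 # t1 @ y1 # t2 @ y2 # x2 # t3 @ x3 # t4 @ [y3])"
proof -
  obtain i x0 where i: "i \<in> {0, 1, 2, 3}"
    and x_eq: "x1 = bar_at i 1 x0" "x2 = bar_at i 2 x0" "x3 = bar_at i 3 x0"
    using obtain_bar_at[OF x] by blast
  obtain j y0 where j: "j \<in> {0, 1, 2, 3}"
    and y_eq: "y1 = bar_at j 1 y0" "y2 = bar_at j 2 y0" "y3 = bar_at j 3 y0"
    using obtain_bar_at[OF y] by blast
  define \<sigma> where "\<sigma> = (\<lambda>n. [[x0], [y0], t1, t2, t3, t4] ! n)"
  have \<sigma>: "\<sigma> 0 = [x0]" "\<sigma> 1 = [y0]" "\<sigma> 2 = t1" "\<sigma> 3 = t2" "\<sigma> 4 = t3" "\<sigma> 5 = t4"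
    by (simp_all add: \<sigma>_def One_nat_def)
  define D where "D = {l \<in> {T1, T2, T3, T4}. subst_letter \<sigma> l = []}"
  have \<sigma>X: "subst_letter \<sigma> (bar_at i k X) = [bar_at i k x0]"
    and \<sigma>Y: "subst_letter \<sigma> (bar_at j k Y) = [bar_at j k y0]" for k
    by (simp_all add: subst_bar_at \<sigma>)
  have "delete_letters D (starred identity_II i j) \<in> diagram_semigroup_identities"
    using i j unfolding diagram_semigroup_identities_def starred_family_def D_def by blast
  from basis_holds[OF this]
  have holds: "semigroup_holds f star (delete_letters D (starred identity_II i j))" .
  have D: "l \<in> D \<longleftrightarrow> subst_letter \<sigma> l = []"
    if "l \<in> set (fst (starred identity_II i j)) \<union> set (snd (starred identity_II i j))" for l
    using that unfolding starred_II[OF i j] D_def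
    by (auto simp: \<sigma>X \<sigma>Y bar_at_notin[OF order_refl, simplified])
  show ?thesis
    using val_subst_deleted[OF holds[unfolded starred_II[OF i j]] D, of \<phi>]
    unfolding starred_II[OF i j] by (simp add: \<sigma>X \<sigma>Y \<sigma> x_eq y_eq)
qed

lemma val_star_III:
  "semigroup_val f star \<phi> (a # t1 @ a # t2 @ bar a # t3 @ [a]) =
   semigroup_val f star \<phi> (a # t1 @ bar a # t2 @ a # t3 @ [a])"
proof -
  define \<sigma> where "\<sigma> = (\<lambda>n. [[a], [], t1, t2, t3] ! n)"
  define D where "D = {l \<in> {T1, T2, T3}. subst_letter \<sigma> l = []}"
  have \<sigma>X: "subst_letter \<sigma> X = [a]" "subst_letter \<sigma> X' = [bar a]"
    and \<sigma>: "\<sigma> 0 = [a]" "\<sigma> 2 = t1" "\<sigma> 3 = t2" "\<sigma> 4 = t3"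
    by (simp_all add: \<sigma>_def inverse_word_def)
  have "delete_letters D identity_III \<in> diagram_semigroup_identities"
    unfolding diagram_semigroup_identities_def D_def by blast
  from basis_holds[OF this]
  have holds: "semigroup_holds f star (delete_letters D identity_III)" .
  have D: "l \<in> D \<longleftrightarrow> subst_letter \<sigma> l = []"
    if "l \<in> set (fst identity_III) \<union> set (snd identity_III)" for l
    using that unfolding identity_III_def D_def by (auto simp: \<sigma>X \<sigma>)
  show ?thesis
    using val_subst_deleted[OF holds[unfolded identity_III_def] D, of \<phi>]
    unfolding identity_III_def by (simp add: \<sigma>X \<sigma>)
qed

lemma val_star_IV:
  "semigroup_val f star \<phi> (a # t1 @ a # t2 @ bar a # t3 @ [bar a]) =
   semigroup_val f star \<phi> (a # t1 @ bar a # t2 @ a # t3 @ [bar a])"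
proof -
  define \<sigma> where "\<sigma> = (\<lambda>n. [[a], [], t1, t2, t3] ! n)"
  define D where "D = {l \<in> {T1, T2, T3}. subst_letter \<sigma> l = []}"
  have \<sigma>X: "subst_letter \<sigma> X = [a]" "subst_letter \<sigma> X' = [bar a]"
    and \<sigma>: "\<sigma> 0 = [a]" "\<sigma> 2 = t1" "\<sigma> 3 = t2" "\<sigma> 4 = t3"
    by (simp_all add: \<sigma>_def inverse_word_def)
  have "delete_letters D identity_IV \<in> diagram_semigroup_identities"
    unfolding diagram_semigroup_identities_def D_def by blast
  from basis_holds[OF this]
  have holds: "semigroup_holds f star (delete_letters D identity_IV)" .
  have D: "l \<in> D \<longleftrightarrow> subst_letter \<sigma> l = []"
    if "l \<in> set (fst identity_IV) \<union> set (snd identity_IV)" for l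
    using that unfolding identity_IV_def D_def by (auto simp: \<sigma>X \<sigma>)
  show ?thesis
    using val_subst_deleted[OF holds[unfolded identity_IV_def] D, of \<phi>]
    unfolding identity_IV_def by (simp add: \<sigma>X \<sigma>)
qed

lemma val_star_core:
  assumes "var_of c = var_of a" "var_of d = var_of a"
  shows "semigroup_val f star \<phi> (c # t1 @ a # t2 @ bar a # t3 @ [d]) =
         semigroup_val f star \<phi> (c # t1 @ bar a # t2 @ a # t3 @ [d])"
  using same_var[OF assms(1)[symmetric]] same_var[OF assms(2)[symmetric]]
    val_star_III[of \<phi> a t1 t2 t3] val_star_IV[of \<phi> a t1 t2 t3]
    val_star_III[of \<phi> "bar a" t1 t2 t3] val_star_IV[of \<phi> "bar a" t1 t2 t3]
  by auto

text \<open>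
  Identity (I) serves the order \<open>x, y, y, x\<close> of the surrounding occurrences and (II) the order
  \<open>x, y, x, y\<close>. The remaining two orders begin with \<open>y\<close> and arise by renaming, which reads the
  identity from right to left.
\<close>

lemma val_swap_core:
  assumes p: "var_of c = var_of a" "var_of d = var_of b"
    and s: "var_of c' = var_of b \<and> var_of d' = var_of a \<or> var_of c' = var_of a \<and> var_of d' = var_of b"
  shows "semigroup_val f star \<phi> (c # t1 @ d # t2 @ a # b # t3 @ c' # t4 @ [d']) =
         semigroup_val f star \<phi> (c # t1 @ d # t2 @ b # a # t3 @ c' # t4 @ [d'])"
  using s
proof
  assume "var_of c' = var_of b \<and> var_of d' = var_of a"
  then show ?thesis using p by (intro val_swap_I) auto
next
  assume "var_of c' = var_of a \<and> var_of d' = var_of b"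
  then show ?thesis using p by (intro val_swap_II) auto
qed

lemma val_swap:
  assumes "var_of c = var_of a \<and> var_of d = var_of b \<or> var_of c = var_of b \<and> var_of d = var_of a"
    and "var_of c' = var_of b \<and> var_of d' = var_of a \<or> var_of c' = var_of a \<and> var_of d' = var_of b"
  shows "semigroup_val f star \<phi> (p @ c # t1 @ d # t2 @ a # b # t3 @ c' # t4 @ d' # s) =
         semigroup_val f star \<phi> (p @ c # t1 @ d # t2 @ b # a # t3 @ c' # t4 @ d' # s)"
proof -
  have "semigroup_val f star \<phi> (c # t1 @ d # t2 @ a # b # t3 @ c' # t4 @ [d']) =
        semigroup_val f star \<phi> (c # t1 @ d # t2 @ b # a # t3 @ c' # t4 @ [d'])"
    using assms val_swap_core[of c a d b c' d' \<phi> t1 t2 t3 t4]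
      val_swap_core[of c b d a c' d' \<phi> t1 t2 t3 t4] by auto
  from val_context[OF _ _ this, of p s] show ?thesis by simp
qed

lemma val_exchange:
  assumes "exchange u v"
  shows "semigroup_val f star \<phi> u = semigroup_val f star \<phi> v"
  using assms
proof cases
  case (swap a b p s)
  obtain p1 c t1 d t2 where p: "p = p1 @ c # t1 @ d # t2"
    "var_of c = var_of a \<and> var_of d = var_of b \<or> var_of c = var_of b \<and> var_of d = var_of a"
    using split_two_vars[OF swap(4,5,3)] .
  obtain t3 c' t4 d' s1 where s: "s = t3 @ c' # t4 @ d' # s1"
    "var_of c' = var_of b \<and> var_of d' = var_of a \<or> var_of c' = var_of a \<and> var_of d' = var_of b"
    using split_two_vars[OF swap(7,6) swap(3)[symmetric]] .
  show ?thesis using val_swap[OF p(2) s(2), of \<phi> p1 t1 t2 t3 t4 s1]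
    by (simp add: swap(1,2) p(1) s(1))
next
  case (star a p s m)
  obtain c p1 t1 where p: "p = p1 @ c # t1" "var_of c = var_of a"
    using split_first_var[OF star(3)] .
  obtain d t3 s1 where s: "s = t3 @ d # s1" "var_of d = var_of a"
    using split_first_var[OF star(4)] .
  show ?thesis
    using val_context[OF _ _ val_star_core[OF p(2) s(2), of \<phi> t1 m t3], of p1 s1]
    by (simp add: star(1,2) p(1) s(1))
qed

lemma val_exchanges:
  "exchange\<^sup>*\<^sup>* u v \<Longrightarrow> semigroup_val f star \<phi> u = semigroup_val f star \<phi> v"
  by (induction rule: rtranclp_induct) (simp_all add: val_exchange)

end


section \<open>From monoids to semigroups\<close>

context involutory_monoid
begin

lemma semigroup_val_eq_monoid_val:
  "w \<noteq> [] \<Longrightarrow> semigroup_val f star \<phi> w = monoid_val f e star \<phi> w"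
proof (induction w)
  case (Cons l w)
  then show ?case by (cases "w = []") (simp_all add: val_Cons)
qed simp

lemma monoid_val_append:
  "monoid_val f e star \<phi> (u @ v) = f (monoid_val f e star \<phi> u) (monoid_val f e star \<phi> v)"
  by (induction u) (simp_all add: assoc)

lemma monoid_val_delete:
  assumes "D \<subseteq> range Var" "\<And>n. Var n \<in> D \<Longrightarrow> Star n \<notin> set w"
  shows "monoid_val f e star \<phi> (filter (\<lambda>l. l \<notin> D) w) =
         monoid_val f e star (\<lambda>n. if Var n \<in> D then e else \<phi> n) w"
  using assms(2)
proof (induction w)
  case (Cons l w)
  then show ?case using assms(1) by (cases l) auto
qed simp

lemma monoid_holds_delete:
  assumes "monoid_holds f e star i" "D \<subseteq> {T1, T2, T3, T4}"
    and "set (fst i) \<union> set (snd i) \<subseteq> range Var \<union> {Star 0, Star 1}"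
  shows "monoid_holds f e star (delete_letters D i)"
proof -
  have "Star n \<notin> set (fst i) \<union> set (snd i)" if "Var n \<in> D" for n
    using subsetD[OF assms(2) that] subsetD[OF assms(3), of "Star n"] by auto
  moreover have "D \<subseteq> range Var" using assms(2) by auto
  ultimately show ?thesis
    using assms(1) by (simp add: monoid_holds_def delete_letters_def on_both_sides_def monoid_val_delete)
qed

text \<open>
  The deleted letters get the unit as value. None of the letters \<open>t\<^sub>k\<close> occurs starred, so
  that deletion removes every trace of its variable.
\<close>

lemma semigroup_holds_basis:
  assumes "\<forall>j\<in>diagram_monoid_identities. monoid_holds f e star j"
    and j: "j \<in> diagram_semigroup_identities"
  shows "semigroup_holds f star j"
proof -
  obtain D i where i: "j = delete_letters D i" "D \<subseteq> {T1, T2, T3, T4}" "i \<in> diagram_monoid_identities"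
    using j unfolding diagram_semigroup_identities_def diagram_monoid_identities_def by blast
  have "set (fst i) \<union> set (snd i) \<subseteq> range Var \<union> {Star 0, Star 1}"
    using i(3) by (rule letters_of_monoid_identities)
  then have "monoid_holds f e star j"
    using assms(1) i by (auto intro: monoid_holds_delete)
  then show ?thesis
    using exchange_nonempty[OF exchange_basis[OF j]]
    by (simp add: semigroup_holds_def monoid_holds_def semigroup_val_eq_monoid_val)
qed

end


section \<open>Exchanges in the diagram monoids\<close>

abbreviation diagram_val ::
  "(nat \<Rightarrow> 'l::comm_semiring_1 diagram) \<Rightarrow> word \<Rightarrow> 'l diagram" where
  "diagram_val \<equiv> monoid_val dmult dunit rotation"

interpretation diagram: involutory_monoid
  "dmult :: 'l::comm_semiring_1 diagram \<Rightarrow> _" dunit rotation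
  by (rule involutory_monoid_diagram)

fun rank0 :: "'l diagram \<Rightarrow> bool" where
  "rank0 (Rank0 a b c) = True"
| "rank0 (Rank2 p q r) = False"

text \<open>
  Each factor of rank 0 that is placed between two diagrams of rank 0 closes one circle more. The
  summand \<open>1\<close> accounts for it and makes the weight additive under multiplication.
\<close>

fun weight :: "'l::comm_semiring_1 diagram \<Rightarrow> 'l" where
  "weight (Rank2 p q r) = p + q + r"
| "weight (Rank0 a b c) = a + b + c + 1"

lemma rank0_dmult [simp]: "rank0 (dmult A B) \<longleftrightarrow> rank0 A \<or> rank0 B"
  by (cases A; cases B) auto

lemma rank0_rotation [simp]: "rank0 (rotation A) = rank0 A"
  by (cases A) auto

lemma weight_dmult [simp]: "weight (dmult A B) = weight A + weight B"
  by (cases A; cases B) (simp_all add: ac_simps)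

lemma weight_rotation [simp]: "weight (rotation A) = weight A"
  by (cases A) (simp_all add: ac_simps)

text \<open>
  The left label of \<open>P\<close> and the right label of \<open>S\<close> are shielded by the strings of \<open>P\<close> and \<open>S\<close>. All
  other labels are summed up in the middle region, so that the order inside \<open>A\<close> is lost.
\<close>

lemma dmult_between_rank0:
  assumes "rank0 P" "rank0 S" "weight A = weight B"
  shows "dmult P (dmult A S) = dmult P (dmult B S)"
proof -
  have "dmult (Rank0 a b c) (dmult M (Rank0 d e f)) = Rank0 a (b + c + weight M + 1 + d + e) f"
    for a b c d e f :: 'a and M
    by (cases M) (simp_all add: ac_simps)
  then show ?thesis using assms by (cases P; cases S) simp_all
qed

lemma dmult_commute_rank2: "\<not> rank0 A \<Longrightarrow> \<not> rank0 B \<Longrightarrow> dmult A B = dmult B A"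
  by (cases A; cases B) (simp_all add: ac_simps)

lemma dmult_rotation_rank2:
  "\<not> rank0 A \<Longrightarrow> dmult A (dmult M (rotation A)) = dmult (rotation A) (dmult M A)"
  by (cases A; cases M) (simp_all add: ac_simps)

lemma rank0_letter: "rank0 (letter_val rotation \<phi> l) = rank0 (\<phi> (var_of l))"
  by (cases l) simp_all

lemma rank0_diagram_val: "rank0 (diagram_val \<phi> w) \<longleftrightarrow> (\<exists>x\<in>vars w. rank0 (\<phi> x))"
  by (induction w) (auto simp: rank0_letter dunit_def)

lemma diagram_val_exchange:
  assumes "exchange u v"
  shows "diagram_val \<phi> u = diagram_val \<phi> v"
  using assms
proof cases
  case (swap a b p s)
  let ?A = "letter_val rotation \<phi> a" and ?B = "letter_val rotation \<phi> b"
  have "dmult (diagram_val \<phi> p) (dmult (dmult ?A ?B) (diagram_val \<phi> s)) =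
        dmult (diagram_val \<phi> p) (dmult (dmult ?B ?A) (diagram_val \<phi> s))"
  proof (cases "rank0 ?A \<or> rank0 ?B")
    case True
    then have "rank0 (diagram_val \<phi> p)" "rank0 (diagram_val \<phi> s)"
      using swap(4-7) unfolding rank0_diagram_val rank0_letter by blast+
    then show ?thesis by (rule dmult_between_rank0) (simp add: ac_simps)
  next
    case False
    then show ?thesis using dmult_commute_rank2[of ?A ?B] by simp
  qed
  then show ?thesis
    by (simp add: swap(1,2) diagram.monoid_val_append diagram.assoc)
next
  case (star a p s m)
  let ?A = "letter_val rotation \<phi> a" and ?M = "diagram_val \<phi> m"
  have "dmult (diagram_val \<phi> p) (dmult (dmult ?A (dmult ?M (rotation ?A))) (diagram_val \<phi> s)) =
        dmult (diagram_val \<phi> p) (dmult (dmult (rotation ?A) (dmult ?M ?A)) (diagram_val \<phi> s))"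
  proof (cases "rank0 ?A")
    case True
    then have "rank0 (diagram_val \<phi> p)" "rank0 (diagram_val \<phi> s)"
      using star(3,4) unfolding rank0_diagram_val rank0_letter by blast+
    then show ?thesis by (rule dmult_between_rank0) (simp add: ac_simps)
  next
    case False
    then show ?thesis by (simp add: dmult_rotation_rank2)
  qed
  then show ?thesis
    by (simp add: star(1,2) diagram.monoid_val_append diagram.assoc diagram.letter_val_bar)
qed


section \<open>What the diagram monoids see of a word\<close>

text \<open>
  The labels are taken in a \<open>linordered_semidom\<close>, which covers the natural numbers and the integers
  at once: numbers of occurrences embed into it and can be recovered from labels.
\<close>

abbreviation occ :: "nat \<Rightarrow> word \<Rightarrow> nat" where
  "occ x w \<equiv> count_list (map var_of w) x"

lemma occ_eq_0_iff: "occ x w = 0 \<longleftrightarrow> x \<notin> vars w"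
  by (simp add: count_list_0_iff)

lemma letter_count_eq:
  assumes "\<And>\<phi> :: nat \<Rightarrow> 'l::linordered_semidom diagram. diagram_val \<phi> u = diagram_val \<phi> v"
  shows "count_list u l = count_list v l"
proof -
  let ?\<phi> = "\<lambda>x n. if n = x then Rank2 1 0 0 else Rank2 0 0 (0::'l)"
  have "diagram_val (?\<phi> x) w = Rank2 (of_nat (count_list w (Var x))) 0 (of_nat (count_list w (Star x)))"
    for x w
  proof (induction w)
    case (Cons l w)
    then show ?case by (cases l) (auto simp: ac_simps)
  qed (simp add: dunit_def)
  then show ?thesis using assms[of "?\<phi> (var_of l)"] by (cases l) auto
qed

lemma diagram_val_rank2:
  assumes "x \<notin> vars w"
  shows "diagram_val ((\<lambda>n. Rank2 0 (if n = y then 1 else 0) 0)(x := Rank0 a 0 c)) w =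
         Rank2 0 (of_nat (occ y w)) 0"
  using assms
proof (induction w)
  case (Cons l w)
  then show ?case by (cases l) (auto simp: ac_simps)
qed (simp add: dunit_def)

fun left_label :: "'l diagram \<Rightarrow> 'l" where
  "left_label (Rank0 a b c) = a"
| "left_label (Rank2 p q r) = q"

fun right_label :: "'l diagram \<Rightarrow> 'l" where
  "right_label (Rank0 a b c) = c"
| "right_label (Rank2 p q r) = q"

lemma left_label_dmult: "rank0 A \<Longrightarrow> left_label (dmult A B) = left_label A"
  by (cases A; cases B) auto

lemma right_label_dmult: "rank0 B \<Longrightarrow> right_label (dmult A B) = right_label B"
  by (cases A; cases B) auto

text \<open>
  If only \<open>x\<close> has rank 0, the left label of a value is determined by the word up to the first
  occurrence of \<open>x\<close>. Middle labels \<open>1\<close> for \<open>y\<close> count the \<open>y\<close> before it; the two labels of \<open>x\<close>, which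
  the rotation interchanges, tell whether that occurrence is starred.
\<close>

lemma first_occurrence_eq:
  assumes eq: "\<And>\<phi> :: nat \<Rightarrow> 'l::linordered_semidom diagram. diagram_val \<phi> (p @ c # s) = diagram_val \<phi> (q @ d # t)"
    and v: "var_of c = x" "var_of d = x" "x \<notin> vars p" "x \<notin> vars q"
  shows "c = d" "occ y p = occ y q"
proof -
  let ?\<phi> = "\<lambda>a c. ((\<lambda>n. Rank2 0 (if n = y then 1 else 0) 0)(x := Rank0 a 0 (c::'l)))"
  have left: "left_label (diagram_val (?\<phi> a b) (p @ c # s)) =
      of_nat (occ y p) + (if c = Var x then a else b)"
    if "var_of c = x" "x \<notin> vars p" for a b p c s
  proof -
    have "left_label (diagram_val (?\<phi> a b) (p @ c # s)) =
      left_label (dmult (diagram_val (?\<phi> a b) p) (letter_val rotation (?\<phi> a b) c))"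
      using that by (simp add: diagram.monoid_val_append rank0_letter left_label_dmult
          flip: diagram.assoc)
    then show ?thesis using that by (cases c) (simp_all add: diagram_val_rank2)
  qed
  have "of_nat (occ y p) = (of_nat (occ y q) :: 'l)"
    using left[OF v(1,3), of 0 0 s] left[OF v(2,4), of 0 0 t] eq[of "?\<phi> 0 0"] by simp
  then show occ: "occ y p = occ y q" by simp
  then show "c = d"
    using left[OF v(1,3), of 1 0 s] left[OF v(2,4), of 1 0 t] eq[of "?\<phi> 1 0"] v(1,2)
    by (cases c; cases d) auto
qed

lemma last_occurrence_eq:
  assumes eq: "\<And>\<phi> :: nat \<Rightarrow> 'l::linordered_semidom diagram. diagram_val \<phi> (p @ c # s) = diagram_val \<phi> (q @ d # t)"
    and v: "var_of c = x" "var_of d = x" "x \<notin> vars s" "x \<notin> vars t"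
  shows "c = d" "occ y s = occ y t"
proof -
  let ?\<phi> = "\<lambda>a c. ((\<lambda>n. Rank2 0 (if n = y then 1 else 0) 0)(x := Rank0 a 0 (c::'l)))"
  have right: "right_label (diagram_val (?\<phi> a b) (p @ c # s)) =
      of_nat (occ y s) + (if c = Var x then b else a)"
    if "var_of c = x" "x \<notin> vars s" for a b p c s
  proof -
    have "right_label (diagram_val (?\<phi> a b) (p @ c # s)) =
      right_label (dmult (letter_val rotation (?\<phi> a b) c) (diagram_val (?\<phi> a b) s))"
      using that by (simp add: diagram.monoid_val_append rank0_letter right_label_dmult)
    then show ?thesis using that by (cases c) (simp_all add: diagram_val_rank2 ac_simps)
  qed
  have "of_nat (occ y s) = (of_nat (occ y t) :: 'l)"
    using right[OF v(1,3), of 0 0 p] right[OF v(2,4), of 0 0 q] eq[of "?\<phi> 0 0"] by simp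
  then show occ: "occ y s = occ y t" by simp
  then show "c = d"
    using right[OF v(1,3), of 1 0 p] right[OF v(2,4), of 1 0 q] eq[of "?\<phi> 1 0"] v(1,2)
    by (cases c; cases d) auto
qed


section \<open>Connecting words by exchanges\<close>

lemma move_to_front:
  assumes "var_of b \<notin> vars w" "var_of b \<in> vars p" "var_of b \<in> vars s"
    and "vars w \<subseteq> vars p" "vars w \<subseteq> vars s"
  shows "exchange\<^sup>*\<^sup>* (p @ w @ b # s) (p @ b # w @ s)"
  using assms
proof (induction w arbitrary: s rule: rev_induct)
  case (snoc c w)
  have "exchange ((p @ w) @ c # b # s) ((p @ w) @ b # c # s)"
    by (rule exchange.swap) (use snoc.prems in auto)
  moreover have "exchange\<^sup>*\<^sup>* (p @ w @ b # c # s) (p @ b # w @ c # s)"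
    by (rule snoc.IH) (use snoc.prems in auto)
  ultimately show ?case by (simp add: converse_rtranclp_into_rtranclp)
qed simp

lemma occ_eq_sum: "occ x w = count_list w (Var x) + count_list w (Star x)"
proof (induction w)
  case (Cons l w)
  then show ?case by (cases l) auto
qed simp

text \<open>
  Write \<open>v = w b s\<close> with \<open>b\<close> the first letter of the variable \<open>x\<close> of \<open>a\<close>. All letters of \<open>w\<close> and \<open>b\<close>
  itself turn out to be inner, because each failure makes two counts differ that the diagram monoid
  sees: on one side \<open>x\<close> comes directly after \<open>p\<close>, on the other side only after \<open>w\<close>.
\<close>

lemma bring_variable_forward:
  assumes eq: "\<And>\<phi> :: nat \<Rightarrow> 'l::linordered_semidom diagram. diagram_val \<phi> (p @ a # u) = diagram_val \<phi> (p @ v)"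
  obtains b v' where "exchange\<^sup>*\<^sup>* (p @ v) (p @ b # v')" "var_of b = var_of a"
proof -
  define x where "x = var_of a"
  have occ_eq: "occ y (a # u) = occ y v" for y
    using letter_count_eq[OF eq, where l = "Var y"] letter_count_eq[OF eq, where l = "Star y"]
      occ_eq_sum[where x = y and w = "a # u"] occ_eq_sum[where x = y and w = v]
    by simp
  have in_v: "y \<in> vars v \<longleftrightarrow> y = x \<or> y \<in> vars u" for y
    using occ_eq[of y] occ_eq_0_iff[where x = y and w = "a # u"] occ_eq_0_iff[where x = y and w = v] by (auto simp: x_def)
  obtain w b s where v: "v = w @ b # s" and b: "var_of b = x" and xw: "x \<notin> vars w"
    using split_first_var[of x v] in_v by blast
  show thesis
  proof (cases "w = []")
    case True
    then show ?thesis using that[of b s] v b x_def by simp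
  next
    case False
    then obtain y where y: "y \<in> vars w" by (cases w) auto
    then have yx: "y \<noteq> x" using xw by auto
    have y_pos: "occ y w > 0" using y occ_eq_0_iff[where x = y and w = w] by simp
    \<comment> \<open>Otherwise the letters before the first \<open>x\<close> would be \<open>p\<close> in one word and \<open>p w\<close> in the other.\<close>
    have xp: "x \<in> vars p"
    proof (rule ccontr)
      assume "x \<notin> vars p"
      moreover have "diagram_val \<phi> (p @ a # u) = diagram_val \<phi> ((p @ w) @ b # s)"
        for \<phi> :: "nat \<Rightarrow> 'l diagram"
        using eq[of \<phi>] unfolding v by simp
      ultimately have "occ y p = occ y (p @ w)"
        using b xw by (intro first_occurrence_eq(2)[of p a u "p @ w" b s x y]) (auto simp: x_def)
      then show False using y_pos by simp
    qed
    \<comment> \<open>Otherwise both words would have a single \<open>x\<close> after \<open>p\<close>, followed by too many \<open>y\<close> in the first.\<close>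
    have xs: "x \<in> vars s"
    proof (rule ccontr)
      assume xs: "x \<notin> vars s"
      have "occ x w = 0" "occ x s = 0" using xw xs by (simp_all only: occ_eq_0_iff not_False_eq_True)
      then have "occ x u = 0" using occ_eq[of x] v b by (simp add: x_def)
      then have "x \<notin> vars u" by (rule iffD1[OF occ_eq_0_iff])
      moreover have "diagram_val \<phi> (p @ a # u) = diagram_val \<phi> ((p @ w) @ b # s)"
        for \<phi> :: "nat \<Rightarrow> 'l diagram"
        using eq[of \<phi>] unfolding v by simp
      ultimately have "occ y u = occ y s"
        using b xs by (intro last_occurrence_eq(2)[of p a u "p @ w" b s x y]) (auto simp: x_def)
      then show False using occ_eq[of y] y_pos yx v b by (simp add: x_def)
    qed
    \<comment> \<open>Otherwise the first \<open>z\<close> would come before \<open>b\<close> here but after \<open>a\<close> there.\<close>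
    have wp: "z \<in> vars p" if z: "z \<in> vars w" for z
    proof (rule ccontr)
      assume zp: "z \<notin> vars p"
      have zx: "z \<noteq> x" using z xw by auto
      obtain w1 c w2 where w: "w = w1 @ c # w2" "var_of c = z" "z \<notin> vars w1"
        using split_first_var[OF z] .
      have "z \<in> vars u" using in_v[of z] z zx v by auto
      then obtain u1 d u2 where u: "u = u1 @ d # u2" "var_of d = z" "z \<notin> vars u1"
        by (rule split_first_var)
      have "diagram_val \<phi> ((p @ a # u1) @ d # u2) = diagram_val \<phi> ((p @ w1) @ c # w2 @ b # s)"
        for \<phi> :: "nat \<Rightarrow> 'l diagram"
        using eq[of \<phi>] unfolding v w(1) u(1) by simp
      then have "occ x (p @ a # u1) = occ x (p @ w1)"
        using w u zp zx
        by (intro first_occurrence_eq(2)[of "p @ a # u1" d u2 "p @ w1" c "w2 @ b # s" z x])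
          (auto simp: x_def)
      moreover have "occ x w1 = 0" using xw w(1) by (intro iffD2[OF occ_eq_0_iff]) auto
      ultimately show False by (simp add: x_def)
    qed
    \<comment> \<open>Otherwise the last \<open>z\<close> would still have all \<open>x\<close> of \<open>v\<close> behind it, whereas \<open>a\<close> precedes it there.\<close>
    have ws: "z \<in> vars s" if z: "z \<in> vars w" for z
    proof (rule ccontr)
      assume zs: "z \<notin> vars s"
      have zx: "z \<noteq> x" using z xw by auto
      obtain w1 c w2 where w: "w = w1 @ c # w2" "var_of c = z" "z \<notin> vars w2"
        using split_last_var[OF z] .
      have "z \<in> vars u" using in_v[of z] z zx v by auto
      then obtain u1 d u2 where u: "u = u1 @ d # u2" "var_of d = z" "z \<notin> vars u2"
        by (rule split_last_var)
      have "diagram_val \<phi> ((p @ a # u1) @ d # u2) = diagram_val \<phi> ((p @ w1) @ c # w2 @ b # s)"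
        for \<phi> :: "nat \<Rightarrow> 'l diagram"
        using eq[of \<phi>] unfolding v w(1) u(1) by simp
      then have "occ x u2 = occ x (w2 @ b # s)"
        using w u zs zx b
        by (intro last_occurrence_eq(2)[of "p @ a # u1" d u2 "p @ w1" c "w2 @ b # s" z x])
          (auto simp: x_def)
      moreover have "occ x w1 = 0" using xw w(1) by (intro iffD2[OF occ_eq_0_iff]) auto
      ultimately show False using occ_eq[of x] v w u zx b by (simp add: x_def)
    qed
    have "exchange\<^sup>*\<^sup>* (p @ w @ b # s) (p @ b # w @ s)"
      by (rule move_to_front) (use b xw xp xs wp ws in auto)
    then show ?thesis using that[of b "w @ s"] v b x_def by simp
  qed
qed

text \<open>
  If \<open>b\<close> is \<open>a\<close> with the star changed, then \<open>b\<close> is traded for the first \<open>a\<close> in \<open>v\<close>. That \<open>a\<close> is not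
  the last occurrence of its variable: otherwise the last letters of that variable, which coincide,
  would be \<open>a\<close>, and there would be two \<open>a\<close> in \<open>a u\<close> but only one in \<open>b v\<close>.
\<close>

lemma bring_letter_forward:
  assumes eq: "\<And>\<phi> :: nat \<Rightarrow> 'l::linordered_semidom diagram. diagram_val \<phi> (p @ a # u) = diagram_val \<phi> (p @ b # v)"
    and b: "var_of b = var_of a"
  obtains v' where "exchange\<^sup>*\<^sup>* (p @ b # v) (p @ a # v')"
proof (cases "b = a")
  case True
  then show ?thesis using that by blast
next
  case False
  then have b_bar: "b = bar a" using same_var[OF b[symmetric]] by simp
  define x where "x = var_of a"
  have count_eq: "count_list (a # u) l = count_list (b # v) l" for l
    using letter_count_eq[OF eq, of l] by simp
  have xp: "x \<in> vars p"
    using first_occurrence_eq(1)[of p a u p b v x] eq b False by (auto simp: x_def)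
  have "a \<in> set v"
    using count_eq[of a] False count_list_0_iff[of v a] by auto
  then obtain v1 v2 where v: "v = v1 @ a # v2" and av1: "a \<notin> set v1"
    using split_list_first by metis
  have xv2: "x \<in> vars v2"
  proof (rule ccontr)
    assume xv2: "x \<notin> vars v2"
    have "b \<in> set u"
      using count_eq[of b] False count_list_0_iff[of u b] by auto
    then have "x \<in> vars u" unfolding x_def b[symmetric] by (rule imageI)
    then obtain u1 c u2 where u: "u = u1 @ c # u2" "var_of c = x" "x \<notin> vars u2"
      by (rule split_last_var)
    have "diagram_val \<phi> ((p @ a # u1) @ c # u2) = diagram_val \<phi> ((p @ b # v1) @ a # v2)"
      for \<phi> :: "nat \<Rightarrow> 'l diagram"
      using eq[of \<phi>] unfolding v u(1) by simp
    then have "c = a"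
      using u xv2 by (intro last_occurrence_eq(1)[of "p @ a # u1" c u2 "p @ b # v1" a v2 x])
        (auto simp: x_def)
    moreover have "count_list v1 a = 0" "count_list v2 a = 0"
      using av1 xv2 x_def by (auto simp: count_list_0_iff)
    ultimately show False using count_eq[of a] u v False by simp
  qed
  have "exchange (p @ b # v1 @ bar b # v2) (p @ bar b # v1 @ b # v2)"
    by (rule exchange.star) (use xp xv2 b x_def in auto)
  then show ?thesis using that[of "v1 @ b # v2"] v b_bar by auto
qed

lemma diagram_val_exchanges:
  "exchange\<^sup>*\<^sup>* u v \<Longrightarrow> diagram_val \<phi> u = diagram_val \<phi> v"
  by (induction rule: rtranclp_induct) (simp_all add: diagram_val_exchange)

lemma exchanges_with_common_prefix:
  assumes "\<And>\<phi> :: nat \<Rightarrow> 'l::linordered_semidom diagram. diagram_val \<phi> (p @ u) = diagram_val \<phi> (p @ v)"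
  shows "exchange\<^sup>*\<^sup>* (p @ v) (p @ u)"
  using assms
proof (induction u arbitrary: p v)
  case Nil
  have "count_list v l = 0" for l
    using letter_count_eq[OF Nil.prems, of l] by simp
  from this[of "hd v"] have "v = []" by (cases v) simp_all
  then show ?case by simp
next
  case (Cons a u)
  obtain b v' where 1: "exchange\<^sup>*\<^sup>* (p @ v) (p @ b # v')" and b: "var_of b = var_of a"
    using bring_variable_forward[OF Cons.prems] by blast
  have eq1: "diagram_val \<phi> (p @ a # u) = diagram_val \<phi> (p @ b # v')" for \<phi> :: "nat \<Rightarrow> 'l diagram"
    using Cons.prems[of \<phi>] diagram_val_exchanges[OF 1, of \<phi>] by simp
  obtain v'' where 2: "exchange\<^sup>*\<^sup>* (p @ b # v') (p @ a # v'')"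
    using bring_letter_forward[OF eq1 b] by blast
  have eq2: "diagram_val \<phi> ((p @ [a]) @ u) = diagram_val \<phi> ((p @ [a]) @ v'')"
    for \<phi> :: "nat \<Rightarrow> 'l diagram"
    using eq1[of \<phi>] diagram_val_exchanges[OF 2, of \<phi>] by simp
  have "exchange\<^sup>*\<^sup>* (p @ a # v'') (p @ a # u)"
    using Cons.IH[OF eq2] by simp
  with 1 2 show ?case by (meson rtranclp_trans)
qed

lemma exchanges_of_diagram_identity:
  assumes "monoid_holds (dmult :: 'l::linordered_semidom diagram \<Rightarrow> _) dunit rotation i"
  shows "exchange\<^sup>*\<^sup>* (snd i) (fst i)"
proof -
  have "diagram_val \<phi> ([] @ fst i) = diagram_val \<phi> ([] @ snd i)" for \<phi> :: "nat \<Rightarrow> 'l diagram"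
    using assms by (simp add: monoid_holds_def)
  from exchanges_with_common_prefix[OF this] show ?thesis by simp
qed

lemma exchanges_empty: "exchange\<^sup>*\<^sup>* u v \<Longrightarrow> u = [] \<longleftrightarrow> v = []"
  by (induction rule: rtranclp_induct) (auto dest: exchange_nonempty)


section \<open>The bases\<close>

lemma diagram_monoid_basis:
  "is_monoid_basis TYPE('m) diagram_monoid_identities
     (dmult :: 'l::linordered_semidom diagram \<Rightarrow> _) dunit rotation"
  unfolding is_monoid_basis_def
proof (intro conjI ballI allI impI; (elim conjE)?)
  fix i assume "i \<in> diagram_monoid_identities"
  then show "monoid_holds (dmult :: 'l diagram \<Rightarrow> _) dunit rotation i"
    using monoid_identities_subset exchange_basis diagram_val_exchange
    unfolding monoid_holds_def by blast
next
  fix i and g :: "'m \<Rightarrow> 'm \<Rightarrow> 'm" and d s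
  assume i: "monoid_holds (dmult :: 'l diagram \<Rightarrow> _) dunit rotation i"
    and g: "involutory_monoid g d s" "\<forall>j\<in>diagram_monoid_identities. monoid_holds g d s j"
  interpret g: involutory_monoid g d s by fact
  interpret g: diagram_variety g s
    by unfold_locales (rule g.semigroup_holds_basis[OF g(2)])
  have ex: "exchange\<^sup>*\<^sup>* (snd i) (fst i)"
    by (rule exchanges_of_diagram_identity[OF i])
  show "monoid_holds g d s i"
  proof (cases "fst i = []")
    case True
    then show ?thesis using exchanges_empty[OF ex] by (simp add: monoid_holds_def)
  next
    case False
    then show ?thesis using exchanges_empty[OF ex] g.val_exchanges[OF ex]
      by (simp add: monoid_holds_def g.semigroup_val_eq_monoid_val)
  qed
qed

lemma diagram_semigroup_basis:
  "is_semigroup_basis TYPE('s) diagram_semigroup_identities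
     (dmult :: 'l::linordered_semidom diagram \<Rightarrow> _) rotation"
proof -
  have holds_iff: "semigroup_holds (dmult :: 'l diagram \<Rightarrow> _) rotation i \<longleftrightarrow>
      monoid_holds (dmult :: 'l diagram \<Rightarrow> _) dunit rotation i" if "i \<in> semigroup_identities" for i
    using that by (auto simp: semigroup_identities_def semigroup_holds_def monoid_holds_def
        diagram.semigroup_val_eq_monoid_val)
  have sub: "diagram_semigroup_identities \<subseteq> semigroup_identities"
    using exchange_nonempty[OF exchange_basis] by (fastforce simp: semigroup_identities_def)
  show ?thesis
    unfolding is_semigroup_basis_def
  proof (intro conjI ballI allI impI; (elim conjE)?)
    show "diagram_semigroup_identities \<subseteq> semigroup_identities" by (rule sub)
  next
    fix i assume i: "i \<in> diagram_semigroup_identities"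
    then have "monoid_holds (dmult :: 'l diagram \<Rightarrow> _) dunit rotation i"
      using exchange_basis diagram_val_exchange unfolding monoid_holds_def by blast
    then show "semigroup_holds (dmult :: 'l diagram \<Rightarrow> _) rotation i"
      using holds_iff i sub by blast
  next
    fix i and g :: "'s \<Rightarrow> 's \<Rightarrow> 's" and s
    assume i: "i \<in> semigroup_identities" "semigroup_holds (dmult :: 'l diagram \<Rightarrow> _) rotation i"
      and g: "involutory_semigroup g s" "\<forall>j\<in>diagram_semigroup_identities. semigroup_holds g s j"
    interpret g: involutory_semigroup g s by fact
    interpret g: diagram_variety g s
      by unfold_locales (use g(2) in blast)
    have "exchange\<^sup>*\<^sup>* (snd i) (fst i)"
      using i holds_iff exchanges_of_diagram_identity by blast
    from g.val_exchanges[OF this] show "semigroup_holds g s i"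
      by (simp add: semigroup_holds_def)
  qed
qed

text \<open>
  Exchanges connect the sides of every identity of the diagram monoid, and every member of the
  variety respects them. An exchange needs nonempty words, so a valid monoid identity with an empty
  side is trivial; all others are semigroup identities.
\<close>

theorem theorem5p40:
  shows "is_monoid_basis TYPE('m) diagram_monoid_identities
           (dmult :: nat diagram \<Rightarrow> nat diagram \<Rightarrow> nat diagram) dunit rotation
    \<and> is_monoid_basis TYPE('m) diagram_monoid_identities
           (dmult :: int diagram \<Rightarrow> int diagram \<Rightarrow> int diagram) dunit rotation
    \<and> is_semigroup_basis TYPE('s) diagram_semigroup_identities
           (dmult :: nat diagram \<Rightarrow> nat diagram \<Rightarrow> nat diagram) rotation
    \<and> is_semigroup_basis TYPE('s) diagram_semigroup_identities
           (dmult :: int diagram \<Rightarrow> int diagram \<Rightarrow> int diagram) rotation"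
  by (intro conjI diagram_monoid_basis diagram_semigroup_basis)

end
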